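(* Let $k,p,n$ be positive integers with $1\le p\le k$. Then $$\gamma_{D_\infty}(k,p,n)=\binom{n+k-p-1}{k-p-1}+\sum_{\substack{0\le l<n\\ l\equiv n \bmod 2}}N(k-p,l)+\sum_{\substack{1\le l\le n\\ l\equiv n\bmod 2}}\ \sum_{q=1}^{l}R(p,q)\,N(k-p,l-q).$$
   Context: The infinite dihedral group is $D_\infty=\mathbb{Z}\rtimes\{\pm1\}$, with underlying set $\mathbb{Z}\times\{\pm1\}$ and product $(a_1,b_1)(a_2,b_2)=(a_1+b_1a_2,\,b_1b_2)$. An element $(a,b)$ is a translation if $b=1$ and a reflection if $b=-1$. For a subset $S$ of a group, $S^n=\{s_1\cdots s_n : s_1,\dots,s_n\in S\}$. For $0\le p\le k$, $$\gamma_{D_\infty}(k,p,n)=\max\{|S^n| : S\subset D_\infty \text{ consists of exactly } p \text{ reflections and } k-p \text{ translations}\}.$$ For integers $x,y\ge 0$, $N(x,y)$ is the number of vectors $(m_1,\dots,m_x)\in\mathbb{Z}^x$ with $\sum_i|m_i|=y$ (so $N(0,y)=1$ if $y=0$ and $0$ otherwise). For integers $x,y\ge1$, $R(x,y)$ is the number of vectors $(m_1,\dots,m_x)\in\mathbb{Z}^x$ whose positive entries sum to $\lceil y/2\rceil$ and whose negative entries sum to $-\lfloor y/2\rfloor$ (so in particular $\sum_i|m_i|=y$). Convention: $\binom{a}{b}=0$ when $b<0$ (this occurs when $p=k$). *)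

theory Defs
  imports Complex_Main "HOL-Algebra.Group" "HOL-Number_Theory.Cong"
begin

definition D_inf :: "(int \<times> int) monoid" where
  "D_inf = \<lparr>carrier = UNIV \<times> {1, -1},
            monoid.mult = (\<lambda>(a1, b1) (a2, b2). (a1 + b1 * a2, b1 * b2)),
            one = (0, 1)\<rparr>"

lemma group_D_inf: "group D_inf"
proof (rule groupI)
  fix x assume "x \<in> carrier D_inf"
  then show "\<exists>y\<in>carrier D_inf. y \<otimes>\<^bsub>D_inf\<^esub> x = \<one>\<^bsub>D_inf\<^esub>"
    by (intro bexI[of _ "(- snd x * fst x, snd x)"]) (auto simp: D_inf_def)
qed (auto simp: D_inf_def algebra_simps)

definition translation_set :: "(int \<times> int) set" where
  "translation_set = {g \<in> carrier D_inf. snd g = 1}"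

definition reflection_set :: "(int \<times> int) set" where
  "reflection_set = {g \<in> carrier D_inf. snd g = -1}"

definition set_pow :: "('a, 'b) monoid_scheme \<Rightarrow> 'a set \<Rightarrow> nat \<Rightarrow> 'a set" where
  "set_pow G S n = {foldr (monoid.mult G) ss (one G) | ss. length ss = n \<and> set ss \<subseteq> S}"

(* The conjunct "finite S" is needed because card is 0 on infinite sets. *)
definition gamma_vals :: "nat \<Rightarrow> nat \<Rightarrow> nat \<Rightarrow> nat set" where
  "gamma_vals k p n = {card (set_pow D_inf S n) | S.
     S \<subseteq> carrier D_inf \<and> finite S \<and>
     card (S \<inter> reflection_set) = p \<and> card (S \<inter> translation_set) = k - p}"

definition gamma_D_inf :: "nat \<Rightarrow> nat \<Rightarrow> nat \<Rightarrow> nat" where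
  "gamma_D_inf k p n = Max (gamma_vals k p n)"

(* Max is unspecified on infinite or empty sets; for p <= k neither case occurs. *)
lemma finite_gamma_vals:
  assumes "p \<le> k"
  shows "finite (gamma_vals k p n)"
proof (rule finite_subset)
  show "gamma_vals k p n \<subseteq> {..k ^ n}"
  proof
    fix c assume "c \<in> gamma_vals k p n"
    then obtain S where S: "c = card (set_pow D_inf S n)" "S \<subseteq> carrier D_inf" "finite S"
      "card (S \<inter> reflection_set) = p" "card (S \<inter> translation_set) = k - p"
      by (auto simp: gamma_vals_def)
    have "S = (S \<inter> reflection_set) \<union> (S \<inter> translation_set)"
      using S(2) by (auto simp: reflection_set_def translation_set_def D_inf_def)
    then have "card S = card ((S \<inter> reflection_set) \<union> (S \<inter> translation_set))"
      by (rule arg_cong)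
    also have "\<dots> = card (S \<inter> reflection_set) + card (S \<inter> translation_set)"
      by (rule card_Un_disjoint)
         (use S(3) in \<open>auto simp: reflection_set_def translation_set_def\<close>)
    finally have "card S = p + (k - p)" using S(4,5) by simp
    then have "card S = k" using assms by simp
    moreover have "set_pow D_inf S n =
        (\<lambda>ss. foldr (monoid.mult D_inf) ss (one D_inf)) ` {ss. set ss \<subseteq> S \<and> length ss = n}"
      by (auto simp: set_pow_def)
    ultimately show "c \<in> {..k ^ n}"
      using S(1) card_image_le[OF finite_lists_length_eq[OF S(3), of n]]
        card_lists_length_eq[OF S(3), of n] by simp
  qed
qed simp

lemma gamma_vals_nonempty: "gamma_vals k p n \<noteq> {}"
proof -
  define A where "A = (\<lambda>i. (int i, -1 :: int)) ` {..<p}"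
  define B where "B = (\<lambda>i. (int i, 1 :: int)) ` {..<k - p}"
  have "(A \<union> B) \<inter> reflection_set = A" "(A \<union> B) \<inter> translation_set = B"
    by (auto simp: A_def B_def reflection_set_def translation_set_def D_inf_def)
  moreover have "card A = p" "card B = k - p"
    by (simp_all add: A_def B_def card_image inj_on_def)
  moreover have "A \<union> B \<subseteq> carrier D_inf" "finite (A \<union> B)"
    by (auto simp: A_def B_def D_inf_def)
  ultimately have "card (set_pow D_inf (A \<union> B) n) \<in> gamma_vals k p n"
    unfolding gamma_vals_def by (intro CollectI exI[of _ "A \<union> B"]) simp
  then show ?thesis by blast
qed

(* Vectors in Z^x are rendered as integer lists of length x. *)

definition N_vec :: "nat \<Rightarrow> nat \<Rightarrow> nat" where
  "N_vec x y = card {ms :: int list. length ms = x \<and> (\<Sum>m\<leftarrow>ms. \<bar>m\<bar>) = int y}"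

definition R_vec :: "nat \<Rightarrow> nat \<Rightarrow> nat" where
  "R_vec x y = card {ms :: int list. length ms = x \<and>
     sum_list (filter (\<lambda>m. m > 0) ms) = \<lceil>real y / 2\<rceil> \<and>
     sum_list (filter (\<lambda>m. m < 0) ms) = - \<lfloor>real y / 2\<rfloor>}"

(* binom a b = 0 for b < 0; natural-number subtraction would instead truncate b to 0. *)
definition binom :: "nat \<Rightarrow> int \<Rightarrow> nat" where
  "binom a b = (if b < 0 then 0 else a choose nat b)"

end

theory Submission
  imports Defs
begin

text \<open>
  A word in reflections $(r_i, -1)$ and translations $(t_j, 1)$ has first coordinate
  $\sum_i u_i r_i + \sum_j v_j t_j$, where the reflections contribute with alternating signs,
  starting with $+$, so that $\sum_i u_i \in \{0, 1\}$, and a translation contributes with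
  the sign $(-1)^s$, where $s$ is the number of reflections to its left. The pairs $(u, v)$
  arising from words of length $n$ are exactly those with $\sum_i u_i \in \{0, 1\}$ and $|u|_1 + |v|_1 \le n$ of the same parity as
  $n$, where in addition $v \ge 0$ if $u = 0$ and $|v|_1 = n$: such a pair leaves no room for a
  cancelling pair of reflections. The number of these pairs bounds $|S^n|$, with equality if the
  $r_i$ and $t_j$ are distinct powers of an integer larger than $2n$.
\<close>

section \<open>Coefficient vectors: norm, sum and pairing\<close>

definition l1 :: "int list \<Rightarrow> int" where
  "l1 u = (\<Sum>x\<leftarrow>u. \<bar>x\<bar>)"

definition dot :: "int list \<Rightarrow> (nat \<Rightarrow> int) \<Rightarrow> int" where
  "dot u r = (\<Sum>i<length u. u ! i * r i)"

lemma l1_nonneg: "0 \<le> l1 u"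
  unfolding l1_def by (rule sum_list_nonneg) auto

lemma l1_eq_0_iff: "l1 u = 0 \<longleftrightarrow> u = replicate (length u) 0"
proof (induction u)
  case (Cons x u)
  have "0 \<le> l1 u" by (rule l1_nonneg)
  with Cons show ?case unfolding l1_def by (auto simp: add_nonneg_eq_0_iff)
qed (simp add: l1_def)

lemma l1_replicate_0 [simp]: "l1 (replicate k 0) = 0"
  by (simp add: l1_def sum_list_replicate)

lemma sum_list_update_group:
  fixes u :: "'a :: ab_group_add list"
  shows "i < length u \<Longrightarrow> sum_list (u[i := x]) = sum_list u + x - u ! i"
  by (induction u arbitrary: i) (auto simp: algebra_simps split: nat.splits)

lemma l1_update: "i < length u \<Longrightarrow> l1 (u[i := x]) = l1 u + \<bar>x\<bar> - \<bar>u ! i\<bar>"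
  by (simp add: l1_def map_update sum_list_update_group)

lemma l1_uminus [simp]: "l1 (map uminus u) = l1 u"
  by (simp add: l1_def comp_def)

lemma sum_list_uminus: "sum_list (map uminus u) = - sum_list (u :: int list)"
  by (induction u) auto

lemma nth_le_l1: "i < length u \<Longrightarrow> \<bar>u ! i\<bar> \<le> l1 u"
  unfolding l1_def by (rule member_le_sum_list) auto

lemma even_l1_sum_list: "even (l1 u + sum_list u)"
  by (induction u) (auto simp: l1_def)

text \<open>Without a positive entry the norm would be minus the sum, hence at most 0. The entry
  found here tells \<open>vecs_Suc_cases\<close> which generator to strip off a word.\<close>

lemma ex_pos_nth:
  assumes "0 \<le> sum_list u" "l1 u \<noteq> 0"
  shows "\<exists>i<length u. 0 < u ! i"
proof (rule ccontr)
  assume "\<not> ?thesis"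
  then have "\<forall>x\<in>set u. x \<le> 0" by (metis in_set_conv_nth not_less)
  then have "l1 u = - sum_list u" by (induction u) (auto simp: l1_def)
  with assms l1_nonneg[of u] show False by linarith
qed

lemma dot_update:
  assumes "i < length u"
  shows "dot (u[i := x]) r = dot u r + (x - u ! i) * r i"
proof -
  have "dot (u[i := x]) r = (\<Sum>j<length u. u ! j * r j + (if j = i then (x - u ! i) * r i else 0))"
    unfolding dot_def using assms
    by (auto intro!: sum.cong simp: nth_list_update algebra_simps)
  also have "\<dots> = dot u r + (x - u ! i) * r i"
    using assms by (simp add: dot_def sum.distrib)
  finally show ?thesis .
qed

lemma dot_uminus: "dot (map uminus u) r = - dot u r"
  by (simp add: dot_def sum_negf)

section \<open>Admissible pairs and multiplication by a generator\<close>

definition eval_vecs :: "(nat \<Rightarrow> int) \<Rightarrow> (nat \<Rightarrow> int) \<Rightarrow> int list \<times> int list \<Rightarrow> int \<times> int" where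
  "eval_vecs r t = (\<lambda>(u, v). (dot u r + dot v t, if sum_list u = 0 then 1 else -1))"

definition vecs :: "nat \<Rightarrow> nat \<Rightarrow> nat \<Rightarrow> (int list \<times> int list) set" where
  "vecs p m n = {(u, v). length u = p \<and> length v = m \<and> sum_list u \<in> {0, 1} \<and>
     l1 u + l1 v \<le> int n \<and> even (int n - (l1 u + l1 v)) \<and>
     (l1 u = 0 \<and> l1 v = int n \<longrightarrow> (\<forall>x\<in>set v. 0 \<le> x))}"

text \<open>The effect on the coefficient vectors of multiplying by a generator from the left.\<close>

definition trans_move :: "nat \<Rightarrow> int list \<times> int list \<Rightarrow> int list \<times> int list" where
  "trans_move j = (\<lambda>(u, v). (u, v[j := v ! j + 1]))"

definition refl_move :: "nat \<Rightarrow> int list \<times> int list \<Rightarrow> int list \<times> int list" where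
  "refl_move i = (\<lambda>(u, v). ((map uminus u)[i := 1 - u ! i], map uminus v))"

text \<open>The norm changes by exactly 1, so bound and parity carry over. If \<open>u\<close> is
  zero and the new norm is n + 1, the old norm was n; then \<open>v\<close> was already nonnegative,
  and raising an entry keeps it so.\<close>

lemma trans_move_in_vecs:
  assumes "w \<in> vecs p m n" "j < m"
  shows "trans_move j w \<in> vecs p m (Suc n)"
proof -
  obtain u v where w: "w = (u, v)" by (cases w)
  have l: "l1 (v[j := v ! j + 1]) = l1 v + (if 0 \<le> v ! j then 1 else -1)"
    using assms by (auto simp: w vecs_def l1_update)
  have "\<forall>x\<in>set (v[j := v ! j + 1]). 0 \<le> x"
    if z: "l1 u = 0" "l1 (v[j := v ! j + 1]) = int (Suc n)"
  proof -
    have "l1 v = int n" using z l assms by (auto simp: w vecs_def split: if_splits)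
    then have *: "\<forall>x\<in>set v. 0 \<le> x" using z assms by (auto simp: w vecs_def)
    then have "0 \<le> v ! j" using assms by (auto simp: w vecs_def)
    with * show ?thesis using set_update_subset_insert[of v j "v ! j + 1"] by fastforce
  qed
  moreover have "l1 u + l1 (v[j := v ! j + 1]) \<le> int (Suc n)"
    "even (int (Suc n) - (l1 u + l1 (v[j := v ! j + 1])))"
    using assms unfolding l by (auto simp: w vecs_def)
  ultimately show ?thesis using assms by (simp add: w vecs_def trans_move_def)
qed

lemma l1_reflect:
  "i < length u \<Longrightarrow> l1 ((map uminus u)[i := 1 - u ! i]) = l1 u + (if 0 < u ! i then -1 else 1)"
  by (auto simp: l1_update)

lemma sum_list_reflect:
  fixes u :: "int list"
  shows "i < length u \<Longrightarrow> sum_list ((map uminus u)[i := 1 - u ! i]) = 1 - sum_list u"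
  by (simp add: sum_list_update_group sum_list_uminus)

text \<open>The first vector becomes e_i - u, whose norm differs from that of \<open>u\<close> by 1.
  It vanishes only for u = e_i; then \<open>v\<close> has norm at most n - 1, so the sign condition
  at level n + 1 is vacuous.\<close>

lemma refl_move_in_vecs:
  assumes "w \<in> vecs p m n" "i < p"
  shows "refl_move i w \<in> vecs p m (Suc n)"
proof -
  obtain u v where w: "w = (u, v)" by (cases w)
  have nn: "0 \<le> l1 u" "0 \<le> l1 v" by (rule l1_nonneg)+
  have "i < length u" using assms by (auto simp: w vecs_def)
  note l = l1_reflect[OF this] and s = sum_list_reflect[OF this]
  let ?u = "(map uminus u)[i := 1 - u ! i]"
  have "l1 ?u + l1 v \<le> int (Suc n)" "even (int (Suc n) - (l1 ?u + l1 v))"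
    using assms unfolding l by (auto simp: w vecs_def)
  moreover have "\<not> (l1 ?u = 0 \<and> l1 v = int (Suc n))"
    using assms nn unfolding l by (auto simp: w vecs_def split: if_splits)
  ultimately show ?thesis using assms s by (auto simp: w vecs_def refl_move_def)
qed

lemma trans_move_dec: "j < length v \<Longrightarrow> trans_move j (u, v[j := v ! j - 1]) = (u, v)"
  by (auto simp: trans_move_def)

text \<open>Reflections are involutions, so the predecessor of a pair under
  \<open>refl_move i\<close> is found by applying the same move again.\<close>

lemma refl_move_refl_move:
  "i < length u \<Longrightarrow> refl_move i (refl_move i (u, v)) = (u, v)"
  by (auto simp: refl_move_def list_eq_iff_nth_eq nth_list_update)

text \<open>Either the move lowers the norm, or the total norm is below n + 1, hence by parity at
  most n - 1, and may grow by 1. The last hypothesis covers the case where the move reaches u = 0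
  with second vector of norm n: that vector is -v, which has to be nonnegative.\<close>

lemma refl_move_in_vecs_down:
  assumes "(u, v) \<in> vecs p m (Suc n)" "i < p"
    and "0 < u ! i \<or> l1 u + l1 v < Suc n"
    and "l1 u = 1 \<and> 0 < u ! i \<and> l1 v = n \<longrightarrow> (\<forall>x\<in>set v. x \<le> 0)"
  shows "refl_move i (u, v) \<in> vecs p m n"
proof -
  have nn: "0 \<le> l1 u" "0 \<le> l1 v" by (rule l1_nonneg)+
  have "i < length u" using assms by (auto simp: vecs_def)
  note l = l1_reflect[OF this] and s = sum_list_reflect[OF this]
  have "even (int (Suc n) - (l1 u + l1 v))" using assms(1) by (simp add: vecs_def del: even_diff)
  then have ne: "l1 u + l1 v \<noteq> int n" by presburger
  let ?u = "(map uminus u)[i := 1 - u ! i]"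
  have "l1 ?u + l1 v \<le> int n" "even (int n - (l1 ?u + l1 v))"
    using assms(1,3) ne unfolding l by (auto simp: vecs_def)
  moreover have "\<forall>x\<in>set v. x \<le> 0" if "l1 ?u = 0" "l1 v = int n"
    using assms(4) that nn unfolding l by (auto split: if_splits)
  ultimately show ?thesis using assms s by (auto simp: vecs_def refl_move_def)
qed

text \<open>Converse of the two closure lemmas: every admissible pair at level n + 1 has an
  admissible predecessor. The choice of the generator to undo depends on whether \<open>u\<close>
  vanishes, on whether \<open>v\<close> exhausts the norm, and on the signs in
  \<open>v\<close>.\<close>

lemma vecs_Suc_cases:
  assumes "(u, v) \<in> vecs p m (Suc n)" "0 < p"
  shows "(\<exists>j<m. \<exists>w\<in>vecs p m n. (u, v) = trans_move j w) \<or>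
         (\<exists>i<p. \<exists>w\<in>vecs p m n. (u, v) = refl_move i w)"
proof -
  have len: "length u = p" "length v = m" using assms by (auto simp: vecs_def)
  have refl: ?thesis if "i < p" "refl_move i (u, v) \<in> vecs p m n" for i
    using that refl_move_refl_move[of i u v] len by metis
  have trans: ?thesis if "j < m" "(u, v[j := v ! j - 1]) \<in> vecs p m n" for j
    using that trans_move_dec[of j v u] len by metis
  have dec: "l1 (v[j := v ! j - 1]) = l1 v - 1" if "j < m" "0 < v ! j" for j
    using that len by (simp add: l1_update)
  consider (pure) "l1 u = 0" "l1 v = Suc n" | (mixed) "l1 u = 0" "l1 v < Suc n" | (nonzero) "l1 u \<noteq> 0"
    using assms by (force simp: vecs_def)
  then show ?thesis
  proof cases
    case pure
    then have pos: "\<forall>x\<in>set v. 0 \<le> x" using assms by (auto simp: vecs_def)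
    then have "0 \<le> sum_list v" by (simp add: sum_list_nonneg)
    then obtain j where j: "j < m" "0 < v ! j" using ex_pos_nth[of v] pure len by auto
    have "\<forall>x\<in>set (v[j := v ! j - 1]). 0 \<le> x"
      using pos j set_update_subset_insert[of v j "v ! j - 1"] by fastforce
    then have "(u, v[j := v ! j - 1]) \<in> vecs p m n"
      using assms pure j by (auto simp: vecs_def dec)
    with j show ?thesis by (intro trans)
  next
    \<comment> \<open>By parity at least two units of length are left over; they are spent on a
      cancelling pair of reflections with index 0, which exists because
      \<open>0 < p\<close>.\<close>
    case mixed
    then show ?thesis using assms by (intro refl[of 0] refl_move_in_vecs_down) auto
  next
    case nonzero
    have "0 \<le> sum_list u" using assms by (auto simp: vecs_def)
    then obtain i where i: "i < p" "0 < u ! i" using ex_pos_nth[of u] nonzero len by auto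
    show ?thesis
    proof (cases "\<forall>x\<in>set v. x \<le> 0")
      \<comment> \<open>Undoing reflection i replaces \<open>v\<close> by -v, which is nonnegative
        here, so the sign condition holds even if the first vector becomes zero.\<close>
      case True
      then show ?thesis using assms i by (intro refl[of i] refl_move_in_vecs_down) auto
    next
      case False
      then obtain j where j: "j < m" "0 < v ! j"
        using len by (auto simp: in_set_conv_nth not_le)
      \<comment> \<open>Undoing a translation keeps \<open>u\<close> nonzero, so no sign condition
        arises.\<close>
      have "(u, v[j := v ! j - 1]) \<in> vecs p m n"
        using assms nonzero j by (auto simp: vecs_def dec)
      with j show ?thesis by (intro trans)
    qed
  qed
qed

lemma vecs_0: "vecs p m 0 = {(replicate p 0, replicate m 0)}"
proof -
  have "l1 u + l1 v \<le> 0 \<longleftrightarrow> l1 u = 0 \<and> l1 v = 0" for u v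
    using l1_nonneg[of u] l1_nonneg[of v] by linarith
  then show ?thesis by (auto simp: vecs_def l1_eq_0_iff sum_list_replicate)
qed

section \<open>Product sets as images of the admissible pairs\<close>

lemma set_pow_0: "set_pow G S 0 = {one G}"
  by (auto simp: set_pow_def)

lemma set_pow_Suc: "set_pow G S (Suc n) = {g \<otimes>\<^bsub>G\<^esub> h | g h. g \<in> S \<and> h \<in> set_pow G S n}"
proof -
  have "\<exists>ss. g \<otimes>\<^bsub>G\<^esub> foldr (monoid.mult G) ss' (one G) = foldr (monoid.mult G) ss (one G) \<and>
      length ss = Suc (length ss') \<and> set ss \<subseteq> S" if "g \<in> S" "set ss' \<subseteq> S" for g ss'
    using that by (intro exI[of _ "g # ss'"]) auto
  then show ?thesis unfolding set_pow_def
    by (fastforce simp: length_Suc_conv)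
qed

lemma eval_trans_move:
  "(u, v) \<in> vecs p m n \<Longrightarrow> j < m \<Longrightarrow>
     eval_vecs r t (trans_move j (u, v)) = (t j, 1) \<otimes>\<^bsub>D_inf\<^esub> eval_vecs r t (u, v)"
  by (auto simp: eval_vecs_def trans_move_def vecs_def dot_update D_inf_def)

text \<open>The sum of \<open>u\<close> becomes 1 minus itself, so it toggles between 0 and 1 and
  the sign in \<open>eval_vecs\<close> flips as the product requires.\<close>

lemma eval_refl_move:
  "(u, v) \<in> vecs p m n \<Longrightarrow> i < p \<Longrightarrow>
     eval_vecs r t (refl_move i (u, v)) = (r i, -1) \<otimes>\<^bsub>D_inf\<^esub> eval_vecs r t (u, v)"
  by (auto simp: eval_vecs_def refl_move_def vecs_def dot_update dot_uminus D_inf_def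
      sum_list_reflect)

text \<open>Induction on n: the closure of \<open>vecs\<close> under the two moves gives one
  inclusion, the existence of predecessors the other. Since \<open>r\<close> and \<open>t\<close>
  are arbitrary, this serves both the upper bound for every S and the extremal example.\<close>

lemma set_pow_eq_eval_vecs:
  fixes r t :: "nat \<Rightarrow> int" and m p n :: nat
  assumes "0 < p"
  defines "S \<equiv> (\<lambda>i. (r i, -1)) ` {..<p} \<union> (\<lambda>j. (t j, 1)) ` {..<m}"
  shows "set_pow D_inf S n = eval_vecs r t ` vecs p m n"
proof (induction n)
  case 0
  show ?case
    by (simp add: set_pow_0 vecs_0) (simp add: D_inf_def eval_vecs_def dot_def sum_list_replicate)
next
  case (Suc n)
  show ?case
  proof (intro equalityI subsetI)
    fix x assume "x \<in> set_pow D_inf S (Suc n)"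
    then obtain g u v where g: "g \<in> S" "x = g \<otimes>\<^bsub>D_inf\<^esub> eval_vecs r t (u, v)"
      and uv: "(u, v) \<in> vecs p m n"
      unfolding set_pow_Suc Suc by auto
    from g(1) consider i where "i < p" "g = (r i, -1)" | j where "j < m" "g = (t j, 1)"
      by (auto simp: S_def)
    then show "x \<in> eval_vecs r t ` vecs p m (Suc n)"
    proof cases
      case 1
      with g uv show ?thesis by (metis eval_refl_move refl_move_in_vecs imageI)
    next
      case 2
      with g uv show ?thesis by (metis eval_trans_move trans_move_in_vecs imageI)
    qed
  next
    fix x assume "x \<in> eval_vecs r t ` vecs p m (Suc n)"
    then obtain u v where uv: "(u, v) \<in> vecs p m (Suc n)" "x = eval_vecs r t (u, v)" by auto
    from vecs_Suc_cases[OF uv(1) assms(1)]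
    obtain g w where "g \<in> S" "w \<in> vecs p m n" "x = g \<otimes>\<^bsub>D_inf\<^esub> eval_vecs r t w"
    proof (elim disjE exE bexE conjE, goal_cases)
      case (1 j w)
      then show ?case using eval_trans_move[of "fst w" "snd w" p m n j r t] uv(2)
        by (intro 1(1)[of "(t j, 1)" w]) (auto simp: S_def)
    next
      case (2 i w)
      then show ?case using eval_refl_move[of "fst w" "snd w" p m n i r t] uv(2)
        by (intro 2(1)[of "(r i, -1)" w]) (auto simp: S_def)
    qed
    then show "x \<in> set_pow D_inf S (Suc n)" unfolding set_pow_Suc Suc by blast
  qed
qed

section \<open>Injectivity for powers of a large base\<close>

lemma horner_sum_inj:
  fixes M B :: int
  assumes "length x = length y" "\<forall>a\<in>set x. \<bar>a\<bar> \<le> B" "\<forall>a\<in>set y. \<bar>a\<bar> \<le> B" "2 * B < M"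
    and "horner_sum (\<lambda>a. a) M x = horner_sum (\<lambda>a. a) M y"
  shows "x = y"
  using assms
proof (induction x y rule: list_induct2)
  case (Cons a x b y)
  let ?h = "horner_sum (\<lambda>a. a) M x" and ?h' = "horner_sum (\<lambda>a. a) M y"
  have eq: "a - b = M * (?h' - ?h)" using Cons.prems by (simp add: algebra_simps)
  have "\<bar>a - b\<bar> < M" using Cons.prems by auto
  then have "a - b = 0" using eq dvd_imp_le_int[of "a - b" M] by auto
  moreover have "M \<noteq> 0" using Cons.prems by auto
  ultimately have "?h = ?h'" using eq by auto
  with Cons \<open>a - b = 0\<close> show ?case by simp
qed simp

lemma dot_powers: "dot u (\<lambda>i. M ^ i) = horner_sum (\<lambda>a. a) M u"
  by (simp add: dot_def horner_sum_eq_sum atLeast0LessThan)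

lemma dot_scale: "dot u (\<lambda>i. c * r i) = c * dot u r"
  by (simp add: dot_def sum_distrib_left mult.left_commute)

text \<open>The first coordinate is the number in base \<open>M\<close> with digit string
  \<open>u @ v\<close>. All digits lie between -n and n, and such balanced digits are unique because
  M > 2n: two lowest digits differ by a multiple of M smaller than M in absolute value.\<close>

lemma inj_on_eval_vecs_powers:
  fixes m p n :: nat
  defines "M \<equiv> 2 * int n + 1"
  shows "inj_on (eval_vecs (\<lambda>i. M ^ i) (\<lambda>i. M ^ (p + i))) (vecs p m n)"
proof (rule inj_onI, clarify)
  fix u v u' v'
  assume uv: "(u, v) \<in> vecs p m n" "(u', v') \<in> vecs p m n"
    and eq: "eval_vecs (\<lambda>i. M ^ i) (\<lambda>i. M ^ (p + i)) (u, v) =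
      eval_vecs (\<lambda>i. M ^ i) (\<lambda>i. M ^ (p + i)) (u', v')"
  have len: "length u = p" "length u' = p" "length v = m" "length v' = m"
    using uv by (auto simp: vecs_def)
  have bound: "\<forall>a\<in>set (x @ y). \<bar>a\<bar> \<le> int n" if "(x, y) \<in> vecs p m n" for x y
  proof -
    have "l1 x + l1 y \<le> int n" using that by (auto simp: vecs_def)
    then have "l1 x \<le> int n" "l1 y \<le> int n"
      using l1_nonneg[of x] l1_nonneg[of y] by linarith+
    then show ?thesis using nth_le_l1[of _ x] nth_le_l1[of _ y]
      by (fastforce simp: in_set_conv_nth)
  qed
  have "horner_sum (\<lambda>a. a) M (u @ v) = horner_sum (\<lambda>a. a) M (u' @ v')"
    using eq len by (simp add: eval_vecs_def power_add dot_scale dot_powers horner_sum_append)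
  then have "u @ v = u' @ v'"
    using bound[OF uv(1)] bound[OF uv(2)] len
    by (intro horner_sum_inj[of _ _ "int n" M]) (auto simp: M_def)
  then show "u = u' \<and> v = v'" using len by auto
qed

section \<open>Counting the admissible pairs\<close>

lemma sum_list_filter_pos: "2 * sum_list (filter (\<lambda>x. 0 < x) u) = l1 u + sum_list u"
  by (induction u) (auto simp: l1_def)

lemma sum_list_filter_neg: "2 * sum_list (filter (\<lambda>x. x < 0) u) = sum_list u - l1 u"
  by (induction u) (auto simp: l1_def)

text \<open>With norm L and sum s, the positive entries sum to (L + s)/2 and the negative ones to (s
  - L)/2. Prescribing the ceiling and floor of q/2 thus means L = q, with s = 0 for even q and s = 1
  for odd q; as s and L have equal parity, allowing either value of s loses nothing.\<close>

lemma R_vec_alt: "R_vec p q = card {u. length u = p \<and> l1 u = int q \<and> sum_list u \<in> {0, 1}}"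
proof -
  have "\<lceil>real q / 2\<rceil> = (int q + 1) div 2" "\<lfloor>real q / 2\<rfloor> = int q div 2" by linarith+
  moreover have "P = (L' + 1) div 2 \<and> N = - (L' div 2) \<longleftrightarrow> L = L' \<and> (s = 0 \<or> s = 1)"
    if "2 * P = L + s" "2 * N = s - L" for P N L L' s :: int
  proof -
    obtain h where "L' = 2 * h \<or> L' = 2 * h + 1" by (metis evenE oddE)
    then show ?thesis
    proof
      assume "L' = 2 * h"
      with that show ?thesis by simp linarith
    next
      assume "L' = 2 * h + 1"
      with that show ?thesis by simp linarith
    qed
  qed
  ultimately have "sum_list (filter (\<lambda>x. 0 < x) u) = \<lceil>real q / 2\<rceil> \<and>
      sum_list (filter (\<lambda>x. x < 0) u) = - \<lfloor>real q / 2\<rfloor> \<longleftrightarrow>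
      l1 u = int q \<and> sum_list u \<in> {0, 1}" for u
    using sum_list_filter_pos[of u] sum_list_filter_neg[of u] by simp
  then show ?thesis by (simp add: R_vec_def)
qed

lemma N_vec_alt: "N_vec m l = card {v. length v = m \<and> l1 v = int l}"
  by (simp add: N_vec_def l1_def)

text \<open>Stars and bars, transferred from lists of naturals.\<close>

lemma card_nonneg_vecs:
  assumes "1 \<le> n"
  shows "card {v :: int list. length v = m \<and> (\<forall>x\<in>set v. 0 \<le> x) \<and> sum_list v = int n} =
    binom (n + m - 1) (int m - 1)"
proof -
  have sum_map: "sum_list (map int l) = int (sum_list l)" for l by (induction l) auto
  have "{v :: int list. length v = m \<and> (\<forall>x\<in>set v. 0 \<le> x) \<and> sum_list v = int n} =
      map int ` {l. length l = m \<and> sum_list l = n}" (is "?A = ?B")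
  proof (intro equalityI subsetI)
    fix v assume v: "v \<in> ?A"
    then have "map int (map nat v) = v" by (simp add: map_idI)
    then show "v \<in> ?B" using v sum_map[of "map nat v"]
      by (intro image_eqI[of _ _ "map nat v"]) auto
  qed (auto simp: sum_map)
  then have "card ?A = (n + m - 1) choose n"
    by (simp add: card_image inj_on_mapI card_length_sum_list)
  also have "\<dots> = binom (n + m - 1) (int m - 1)"
  proof (cases m)
    \<comment> \<open>Both sides are 0: \<open>n - 1 choose n\<close> vanishes because n is
      positive, and \<open>binom\<close> vanishes at the lower index -1.\<close>
    case 0
    then show ?thesis using assms by (simp add: binom_def)
  next
    case (Suc m')
    then show ?thesis using binomial_symmetric[of n "n + m'"] by (simp add: binom_def)
  qed
  finally show ?thesis .
qed

lemma finite_l1_vecs: "finite {v. length v = m \<and> l1 v = c}"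
proof (rule finite_subset)
  show "{v. length v = m \<and> l1 v = c} \<subseteq> {v. set v \<subseteq> {-c..c} \<and> length v = m}"
    using nth_le_l1 by (fastforce simp: in_set_conv_nth)
qed (simp add: finite_lists_length_eq)

lemma finite_vecs: "finite (vecs p m n)"
proof (rule finite_subset)
  show "vecs p m n \<subseteq> (\<Union>c\<in>{0..int n}. {u. length u = p \<and> l1 u = c}) \<times>
      (\<Union>c\<in>{0..int n}. {v. length v = m \<and> l1 v = c})"
  proof
    fix w assume "w \<in> vecs p m n"
    then show "w \<in> (\<Union>c\<in>{0..int n}. {u. length u = p \<and> l1 u = c}) \<times>
        (\<Union>c\<in>{0..int n}. {v. length v = m \<and> l1 v = c})"
      using l1_nonneg[of "fst w"] l1_nonneg[of "snd w"] by (auto simp: vecs_def)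
  qed
qed (auto intro: finite_l1_vecs)

lemma l1_eq_sum_list: "\<forall>x\<in>set v. 0 \<le> x \<Longrightarrow> l1 v = sum_list v"
  by (induction v) (auto simp: l1_def)

text \<open>The three summands count disjoint pieces: \<open>A\<close> has u = 0 and
  \<open>v\<close> of norm n, \<open>B\<close> has u = 0 and \<open>v\<close> of smaller norm l, and
  \<open>C\<close> has u nonzero. In \<open>C\<close>, l is the total norm and q the norm of
  \<open>u\<close>.\<close>

lemma card_vecs:
  fixes m p n :: nat
  assumes "1 \<le> n"
  shows "card (vecs p m n) = binom (n + m - 1) (int m - 1)
      + (\<Sum>l | 0 \<le> l \<and> l < n \<and> [l = n] (mod 2). N_vec m l)
      + (\<Sum>l | 1 \<le> l \<and> l \<le> n \<and> [l = n] (mod 2). \<Sum>q = 1..l. R_vec p q * N_vec m (l - q))"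
proof -
  define U where "U q = {u. length u = p \<and> l1 u = int q \<and> sum_list u \<in> {0, 1}}" for q
  define V where "V l = {v. length v = m \<and> l1 v = int l}" for l
  define A where "A = {replicate p (0::int)} \<times>
    {v :: int list. length v = m \<and> (\<forall>x\<in>set v. 0 \<le> x) \<and> sum_list v = int n}"
  define L where "L = {l. 0 \<le> l \<and> l < n \<and> [l = n] (mod 2)}"
  define B where "B = (\<Union>l\<in>L. {replicate p (0::int)} \<times> V l)"
  define L' where "L' = {l. 1 \<le> l \<and> l \<le> n \<and> [l = n] (mod 2)}"
  define K where "K = (SIGMA l:L'. {1..l})"
  define C where "C = (\<Union>(l, q)\<in>K. U q \<times> V (l - q))"
  have fin: "finite (U q)" "finite (V l)" for q l
    unfolding U_def V_def
    by (rule finite_subset[OF _ finite_l1_vecs[of p "int q"]], blast) (rule finite_l1_vecs)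
  have finL: "finite L" "finite L'" "finite K" unfolding K_def L_def L'_def by auto
  have mod2: "[l = n] (mod 2) \<longleftrightarrow> even (int n - int l)" for l
    unfolding cong_def by presburger
  have "A \<subseteq> vecs p m n"
    by (auto simp: A_def vecs_def sum_list_replicate l1_eq_sum_list)
  moreover have "B \<subseteq> vecs p m n"
    by (auto simp: B_def V_def L_def vecs_def sum_list_replicate mod2)
  moreover have "C \<subseteq> vecs p m n"
    by (auto simp: C_def U_def V_def K_def L'_def vecs_def mod2)
  moreover have "w \<in> A \<union> B \<union> C" if mem: "w \<in> vecs p m n" for w
  proof -
    obtain u v where w: "w = (u, v)" by (cases w)
    obtain a b where ab: "l1 u = int a" "l1 v = int b"
      by (meson l1_nonneg nonneg_int_cases)
    consider "a = 0" "b = n" | "a = 0" "b < n" | "1 \<le> a"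
      using mem ab by (force simp: w vecs_def)
    then show ?thesis
    proof cases
      case 1
      then have "w \<in> A" using that ab by (auto simp: A_def w vecs_def l1_eq_0_iff l1_eq_sum_list)
      then show ?thesis by blast
    next
      case 2
      then have "b \<in> L" "v \<in> V b" "u = replicate p 0"
        using that ab by (auto simp: L_def V_def w vecs_def mod2 l1_eq_0_iff)
      then have "w \<in> B" unfolding B_def w by blast
      then show ?thesis by blast
    next
      case 3
      then have "(a + b, a) \<in> K" "u \<in> U a" "v \<in> V (a + b - a)"
        using that ab by (auto simp: K_def L'_def U_def V_def w vecs_def mod2)
      then have "w \<in> C" unfolding C_def w by blast
      then show ?thesis by blast
    qed
  qed
  ultimately have eq: "vecs p m n = A \<union> B \<union> C" by blast
  have finABC: "finite A" "finite B" "finite C"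
    using finite_vecs[of p m n] by (auto simp: eq)
  \<comment> \<open>\<open>A\<close> and \<open>B\<close> differ in the norm of \<open>v\<close>;
    \<open>C\<close> is separated from both by the norm of \<open>u\<close>, as q starts at
    1.\<close>
  have AB: "A \<inter> B = {}" by (auto simp: A_def B_def V_def L_def l1_eq_sum_list)
  have "l1 (fst w) = 0" if "w \<in> A \<union> B" for w using that by (auto simp: A_def B_def)
  moreover have "l1 (fst w) \<noteq> 0" if "w \<in> C" for w using that by (auto simp: C_def K_def U_def)
  ultimately have ABC: "(A \<union> B) \<inter> C = {}" by blast
  have "card (vecs p m n) = card A + card B + card C"
    using AB ABC finABC by (simp add: eq card_Un_disjoint)
  moreover have "card A = binom (n + m - 1) (int m - 1)"
    using card_nonneg_vecs[OF assms, of m] by (simp add: A_def card_cartesian_product_singleton)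
  moreover have "card B = (\<Sum>l\<in>L. N_vec m l)"
    unfolding B_def by (subst card_UN_disjoint)
      (use fin finL in \<open>auto simp: card_cartesian_product_singleton N_vec_alt V_def\<close>)
  moreover have "card C = (\<Sum>l\<in>L'. \<Sum>q = 1..l. R_vec p q * N_vec m (l - q))"
  proof -
    have "card C = (\<Sum>x\<in>K. card (case x of (l, q) \<Rightarrow> U q \<times> V (l - q)))"
      unfolding C_def
    proof (rule card_UN_disjoint)
      \<comment> \<open>The norms of the two vectors determine q and l - q, and hence l, because q
        <= l in \<open>K\<close> rules out truncated subtraction.\<close>
      show "\<forall>x\<in>K. \<forall>y\<in>K. x \<noteq> y \<longrightarrow> (case x of (l, q) \<Rightarrow> U q \<times> V (l - q)) \<inter>
          (case y of (l, q) \<Rightarrow> U q \<times> V (l - q)) = {}"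
        by (auto simp: U_def V_def K_def)
    qed (use finL fin in auto)
    also have "\<dots> = (\<Sum>(l, q)\<in>K. R_vec p q * N_vec m (l - q))"
      by (intro sum.cong) (auto simp: card_cartesian_product R_vec_alt N_vec_alt U_def V_def)
    also have "\<dots> = (\<Sum>l\<in>L'. \<Sum>q = 1..l. R_vec p q * N_vec m (l - q))"
      unfolding K_def using finL by (subst sum.Sigma) auto
    finally show ?thesis .
  qed
  ultimately show ?thesis by (simp add: L_def L'_def)
qed

section \<open>The maximum over all generating sets\<close>

theorem theorem1p1:
  fixes k p n :: nat
  assumes "n \<ge> 1" and "1 \<le> p" and "p \<le> k"
  shows "gamma_D_inf k p n =
      binom (n + k - p - 1) (int k - int p - 1)
      + (\<Sum>l | 0 \<le> l \<and> l < n \<and> [l = n] (mod 2). N_vec (k - p) l)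
      + (\<Sum>l | 1 \<le> l \<and> l \<le> n \<and> [l = n] (mod 2).
           \<Sum>q = 1..l. R_vec p q * N_vec (k - p) (l - q))"
proof -
  have "gamma_D_inf k p n = card (vecs p (k - p) n)"
    unfolding gamma_D_inf_def
  proof (rule Max_eqI[OF finite_gamma_vals[OF assms(3)]])
    fix c assume "c \<in> gamma_vals k p n"
    then obtain S where S: "c = card (set_pow D_inf S n)" "S \<subseteq> carrier D_inf" "finite S"
      "card (S \<inter> reflection_set) = p" "card (S \<inter> translation_set) = k - p"
      by (auto simp: gamma_vals_def)
    \<comment> \<open>Enumerating the reflections and the translations of S puts it into the indexed
      form of \<open>set_pow_eq_eval_vecs\<close>; an image is then no larger than
      \<open>vecs\<close>.\<close>
    obtain f where f: "bij_betw f {..<p} (S \<inter> reflection_set)"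
      using ex_bij_betw_nat_finite[of "S \<inter> reflection_set"] S by (auto simp: atLeast0LessThan)
    obtain g where g: "bij_betw g {..<k - p} (S \<inter> translation_set)"
      using ex_bij_betw_nat_finite[of "S \<inter> translation_set"] S by (auto simp: atLeast0LessThan)
    have "f i = (fst (f i), -1)" if "i < p" for i
      using bij_betwE[OF f] that by (auto simp: reflection_set_def prod_eq_iff)
    then have "S \<inter> reflection_set = (\<lambda>i. (fst (f i), -1)) ` {..<p}"
      using bij_betw_imp_surj_on[OF f] by (metis (no_types, lifting) image_cong lessThan_iff)
    moreover have "g j = (fst (g j), 1)" if "j < k - p" for j
      using bij_betwE[OF g] that by (auto simp: translation_set_def prod_eq_iff)
    then have "S \<inter> translation_set = (\<lambda>j. (fst (g j), 1)) ` {..<k - p}"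
      using bij_betw_imp_surj_on[OF g] by (metis (no_types, lifting) image_cong lessThan_iff)
    moreover have "S = (S \<inter> reflection_set) \<union> (S \<inter> translation_set)"
      using S(2) by (auto simp: reflection_set_def translation_set_def D_inf_def)
    ultimately have "set_pow D_inf S n = eval_vecs (fst \<circ> f) (fst \<circ> g) ` vecs p (k - p) n"
      using set_pow_eq_eval_vecs[of p "fst \<circ> f" "fst \<circ> g" "k - p" n] assms(2) by simp
    then show "c \<le> card (vecs p (k - p) n)" using S(1) finite_vecs card_image_le by metis
  next
    define M where "M = 2 * int n + 1"
    define r t where "r = (\<lambda>i. M ^ i)" and "t = (\<lambda>i. M ^ (p + i))"
    define A B where "A = (\<lambda>i. (r i, -1 :: int)) ` {..<p}" and "B = (\<lambda>j. (t j, 1 :: int)) ` {..<k - p}"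
    \<comment> \<open>A base above 1 has distinct powers, so the example has exactly p reflections
      and k - p translations.\<close>
    have "1 < M" using assms(1) by (simp add: M_def)
    then have card: "card A = p" "card B = k - p"
      by (simp_all add: A_def B_def r_def t_def card_image inj_on_def)
    have sub: "(A \<union> B) \<inter> reflection_set = A" "(A \<union> B) \<inter> translation_set = B"
      "A \<union> B \<subseteq> carrier D_inf" "finite (A \<union> B)"
      by (auto simp: A_def B_def reflection_set_def translation_set_def D_inf_def)
    have "set_pow D_inf (A \<union> B) n = eval_vecs r t ` vecs p (k - p) n"
      unfolding A_def B_def using assms(2) by (intro set_pow_eq_eval_vecs) simp
    then have "card (set_pow D_inf (A \<union> B) n) = card (vecs p (k - p) n)"
      using inj_on_eval_vecs_powers[of n p "k - p"] by (simp add: card_image r_def t_def M_def)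
    then show "card (vecs p (k - p) n) \<in> gamma_vals k p n"
      unfolding gamma_vals_def using sub card by (intro CollectI exI[of _ "A \<union> B"]) simp
  qed
  also have "\<dots> = binom (n + (k - p) - 1) (int (k - p) - 1)
      + (\<Sum>l | 0 \<le> l \<and> l < n \<and> [l = n] (mod 2). N_vec (k - p) l)
      + (\<Sum>l | 1 \<le> l \<and> l \<le> n \<and> [l = n] (mod 2).
           \<Sum>q = 1..l. R_vec p q * N_vec (k - p) (l - q))"
    using assms(1) by (rule card_vecs)
  finally show ?thesis using assms by simp
qed

end
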